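(* Let $a\ge 2$ be a fixed integer. Over all 2-colorings of $[1,n]$, the minimum number of monochromatic triples $(x,y,z)$ satisfying $x+ay=z$ is $$\frac{n^2}{2a(a^2+2a+3)}+\mathcal{O}(n)\qquad (n\to\infty),$$ where the constant implied by $\mathcal{O}(n)$ may depend on $a$.
   Context: For a positive integer $n$, $[1,n]=\{1,\dots,n\}$. A 2-coloring of $[1,n]$ assigns to each integer in $[1,n]$ one of the two colors red, blue. The triples counted are all triples $(x,y,z)$ of integers in $[1,n]$ with $z=x+ay$ (equivalently, all pairs $(x,y)$ of positive integers with $x+ay\le n$; $x=y$ is allowed). Such a triple is monochromatic if $x,y,z$ all have the same color. *)

theory Defs
  imports "HOL-Library.FuncSet" "HOL-Library.Landau_Symbols"
begin

datatype color = Red | Blue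

text \<open>Extensional functions, so that there are exactly \<open>2 ^ n\<close> colorings of \<open>[1,n]\<close>.\<close>

definition colorings :: "nat \<Rightarrow> (nat \<Rightarrow> color) set" where
  "colorings n = {1..n} \<rightarrow>\<^sub>E UNIV"

definition mono_triples :: "nat \<Rightarrow> nat \<Rightarrow> (nat \<Rightarrow> color) \<Rightarrow> (nat \<times> nat \<times> nat) set" where
  "mono_triples a n c =
     {(x, y, z). x \<in> {1..n} \<and> y \<in> {1..n} \<and> z \<in> {1..n} \<and>
                 x + a * y = z \<and> c x = c y \<and> c y = c z}"

definition min_mono_triples :: "nat \<Rightarrow> nat \<Rightarrow> nat" where
  "min_mono_triples a n = Min ((\<lambda>c. card (mono_triples a n c)) ` colorings n)"

text \<open>The sets are finite and \<open>colorings n\<close> is nonempty, so \<^const>\<open>Min\<close> and \<^const>\<open>card\<close> above are not degenerate.\<close>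

lemma UNIV_color: "(UNIV :: color set) = {Red, Blue}"
  using color.exhaust by auto

lemma finite_colorings: "finite (colorings n)"
  unfolding colorings_def UNIV_color by (intro finite_PiE) auto

lemma colorings_nonempty: "colorings n \<noteq> {}"
  unfolding colorings_def by (simp add: PiE_eq_empty_iff)

lemma card_colorings: "card (colorings n) = 2 ^ n"
  unfolding colorings_def UNIV_color by (simp add: card_PiE numeral_2_eq_2)

lemma finite_mono_triples: "finite (mono_triples a n c)"
  by (rule finite_subset[of _ "{1..n} \<times> {1..n} \<times> {1..n}"])
     (auto simp: mono_triples_def)

end

theory Submission
  imports Defs
begin

text \<open>
  Upper bound: with \<open>D = a\<^sup>2 + 2a + 3\<close>, color \<open>[1, (a+1)n/D]\<close> and \<open>(n - n/D, n]\<close> red and the rest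
  blue. The monochromatic triples then fall into three families of sizes \<open>u\<^sup>2/2a\<close>, \<open>v\<^sup>2/2a\<close>,
  \<open>w\<^sup>2/2a\<close>, where \<open>u + w + (a+1)v = n\<close>; this choice minimizes \<open>u\<^sup>2 + v\<^sup>2 + w\<^sup>2\<close> on that plane.

  Lower bound: encode the coloring by signs \<open>f\<close> with partial sums \<open>P\<close> and expand four times the
  number of monochromatic triples as a quadratic form in \<open>f\<close>. The products \<open>f x * f z\<close> contribute
  at least \<open>P(n)\<^sup>2/2a - O(n)\<close> by Cauchy-Schwarz over the residue classes modulo \<open>a\<close>. The other two
  products contribute the sum of \<open>f y * (P n + G y)\<close> over \<open>y \<le> n/a\<close>, where
  \<open>G y = P (n - ay) - P (ay)\<close>. This \<open>G\<close> is almost antisymmetric under \<open>y \<mapsto> n/a - y\<close>, and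
  its modulus lies below a trapezoid whose height is determined by \<open>P n\<close> and \<open>P (n div a)\<close>.
  Shifting \<open>G\<close> by a Lagrange multiplier \<open>\<mu>\<close> for the sum of \<open>f y\<close> over \<open>y \<le> n/a\<close> and estimating
  the shifted sum by absolute values turns the form into a sum of three squares, to which
  Cauchy-Schwarz applies on the same plane as above.
\<close>

subsection \<open>Sums of hinge functions\<close>

text \<open>\<open>(max 0 x)\<^sup>2\<close> is an antiderivative of \<open>2 * max 0 x\<close>,
  which is monotone with Lipschitz constant 2; integrating from \<open>x - h\<close> to
  \<open>x\<close> explains both bounds.\<close>

lemma hinge_step:
  fixes x h :: real
  assumes "0 \<le> h"
  shows "2 * h * max 0 (x - h) \<le> (max 0 x)\<^sup>2 - (max 0 (x - h))\<^sup>2"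
    and "(max 0 x)\<^sup>2 - (max 0 (x - h))\<^sup>2 \<le> 2 * h * max 0 (x - h) + h\<^sup>2"
proof -
  consider "x \<le> 0" | "0 < x" "x \<le> h" | "h < x"
    by linarith
  then have "2 * h * max 0 (x - h) \<le> (max 0 x)\<^sup>2 - (max 0 (x - h))\<^sup>2 \<and>
    (max 0 x)\<^sup>2 - (max 0 (x - h))\<^sup>2 \<le> 2 * h * max 0 (x - h) + h\<^sup>2"
  proof cases
    case 2
    then have "x\<^sup>2 \<le> h\<^sup>2" by (intro power_mono) auto
    with 2 show ?thesis by (simp add: max_def)
  qed (use assms in \<open>auto simp: max_def power2_eq_square algebra_simps\<close>)
  then show "2 * h * max 0 (x - h) \<le> (max 0 x)\<^sup>2 - (max 0 (x - h))\<^sup>2"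
    and "(max 0 x)\<^sup>2 - (max 0 (x - h))\<^sup>2 \<le> 2 * h * max 0 (x - h) + h\<^sup>2"
    by blast+
qed

text \<open>Telescoping \<open>hinge_step\<close> with step \<open>2 * real a\<close> turns the sum
  into a difference of two squares, up to an error linear in \<open>m\<close>.\<close>

lemma hinge_sum:
  fixes a m :: nat and b :: real
  defines "H \<equiv> \<Sum>y = 1..m. max 0 (b - 2 * real a * real y)"
    and "Q \<equiv> (max 0 b)\<^sup>2 - (max 0 (b - 2 * real a * real m))\<^sup>2"
  shows "4 * real a * H \<le> Q" and "Q \<le> 4 * real a * H + 4 * (real a)\<^sup>2 * real m"
proof -
  have "4 * real a * H \<le> Q \<and> Q \<le> 4 * real a * H + 4 * (real a)\<^sup>2 * real m"
    unfolding H_def Q_def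
  proof (induction m)
    case (Suc m)
    have shift: "b - 2 * real a * real m - 2 * real a = b - 2 * real a * real (Suc m)"
      by (simp add: algebra_simps)
    show ?case
      using Suc hinge_step[of "2 * real a" "b - 2 * real a * real m"]
      unfolding shift by (simp add: algebra_simps power2_eq_square)
  qed auto
  then show "4 * real a * H \<le> Q" and "Q \<le> 4 * real a * H + 4 * (real a)\<^sup>2 * real m"
    by blast+
qed

lemma tent_eq_hinges:
  fixes x k :: real
  assumes "0 \<le> k"
  shows "max 0 (k - \<bar>x\<bar>) = max 0 (x + k) - 2 * max 0 x + max 0 (x - k)"
  using assms by (auto simp: max_def abs_if)

lemma real_div_bounds:
  fixes a n :: nat
  assumes "0 < a"
  shows "real a * real (n div a) \<le> real n" and "real n \<le> real a * real (n div a) + real a"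
proof -
  have "a * (n div a) \<le> n" "n \<le> a * (n div a) + a"
    using assms by (simp, metis add_left_mono div_mult_mod_eq less_imp_le mod_less_divisor mult.commute)
  then show "real a * real (n div a) \<le> real n" and "real n \<le> real a * real (n div a) + real a"
    by (metis of_nat_le_iff of_nat_mult, metis of_nat_add of_nat_le_iff of_nat_mult)
qed

text \<open>Since \<open>a * m\<close> is within \<open>a\<close> of \<open>n\<close>, the square
  left over at the far end of \<open>hinge_sum\<close> is bounded independently of
  \<open>n\<close>.\<close>

lemma hinge_tail:
  fixes a m n :: nat and b :: real
  assumes "m = n div a" "0 < a" "b \<le> 2 * real n"
  shows "(max 0 (b - 2 * real a * real m))\<^sup>2 \<le> 4 * (real a)\<^sup>2"
proof -
  have "max 0 (b - 2 * real a * real m) \<le> 2 * real a"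
    using assms(1,3) real_div_bounds(2)[OF assms(2), of n] by auto
  then have "(max 0 (b - 2 * real a * real m))\<^sup>2 \<le> (2 * real a)\<^sup>2"
    by (intro power_mono) auto
  then show ?thesis by (simp add: power2_eq_square)
qed

lemma hinge_sum_lower:
  fixes a m n :: nat and b :: real
  assumes "m = n div a" "0 < a" "0 \<le> b" "b \<le> real n"
  shows "b\<^sup>2 - 4 * real a * real n - 4 * (real a)\<^sup>2 \<le>
    4 * real a * (\<Sum>y = 1..m. max 0 (b - 2 * real a * real y))"
proof -
  have "real a * real m \<le> real n"
    using assms(1) real_div_bounds(1)[OF assms(2)] by simp
  then have "real a * (real a * real m) \<le> real a * real n"
    by (intro mult_left_mono) auto
  then show ?thesis
    using hinge_sum(2)[where a = a and m = m and b = b] hinge_tail[OF assms(1,2), of b] assms(3,4)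
    by (simp add: power2_eq_square algebra_simps)
qed

text \<open>The tent, centred at \<open>2 * a * y = n\<close>, is a second difference of hinges; the
  three squares that \<open>hinge_sum\<close> yields combine to
  \<open>2 * k\<^sup>2\<close>.\<close>

lemma tent_sum:
  fixes a m n :: nat and k :: real
  assumes "m = n div a" "0 < a" "0 \<le> k" "k \<le> real n"
  shows "\<bar>2 * real a * (\<Sum>y = 1..m. max 0 (k - \<bar>real n - 2 * real a * real y\<bar>)) - k\<^sup>2\<bar>
    \<le> 4 * real a * real n + 4 * (real a)\<^sup>2"
proof -
  define H where "H b = (\<Sum>y = 1..m. max 0 (b - 2 * real a * real y))" for b
  have split: "(\<Sum>y = 1..m. max 0 (k - \<bar>real n - 2 * real a * real y\<bar>))
      = H (real n + k) - 2 * H (real n) + H (real n - k)"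
    unfolding H_def tent_eq_hinges[OF assms(3)]
    by (simp add: sum.distrib sum_subtractf sum_distrib_left algebra_simps)
  have "real a * real m \<le> real n"
    using assms(1) real_div_bounds(1)[OF assms(2)] by simp
  then have am: "(real a)\<^sup>2 * real m \<le> real a * real n"
    by (simp add: power2_eq_square mult.assoc mult_left_mono)
  have H: "4 * real a * H b \<le> b\<^sup>2 \<and> b\<^sup>2 \<le> 4 * real a * H b + 4 * real a * real n + 4 * (real a)\<^sup>2"
    if "0 \<le> b" "b \<le> 2 * real n" for b
  proof -
    have "(max 0 b)\<^sup>2 = b\<^sup>2" using that by simp
    then show ?thesis
      using hinge_sum[where a = a and m = m and b = b] hinge_tail[OF assms(1,2), of b] that am
        zero_le_power2[of "max 0 (b - 2 * real a * real m)"]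
      unfolding H_def by linarith
  qed
  have "(real n + k)\<^sup>2 - 2 * (real n)\<^sup>2 + (real n - k)\<^sup>2 = 2 * k\<^sup>2"
    by (simp add: power2_eq_square algebra_simps)
  then show ?thesis
    using H[of "real n + k"] H[of "real n"] H[of "real n - k"] assms(3,4)
    unfolding split by (simp add: algebra_simps abs_le_iff)
qed

text \<open>
  The assumption \<open>2 * k \<le> n + s\<close> says that the slopes starting at height \<open>s\<close> reach the plateau
  \<open>k\<close> before the central tent does, so at most one of the subtracted terms is nonzero.
\<close>

lemma trapezoid_bound:
  fixes g k l n s t :: real
  assumes "0 \<le> t" "t \<le> n" "0 \<le> l" "l \<le> s" "s \<le> k" "2 * k \<le> n + s"
    and "g \<le> k" "g \<le> s + 2 * t" "g \<le> s + 2 * (n - t)" "g \<le> \<bar>n - 2 * t\<bar>"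
  shows "max g l \<le> k - max 0 (k - s - 2 * t) - max 0 (k - s - 2 * (n - t))
    - max 0 (k - \<bar>n - 2 * t\<bar>) + max 0 (l - \<bar>n - 2 * t\<bar>)"
  using assms by (simp add: max_def abs_if split: if_splits)

text \<open>This sums \<open>trapezoid_bound\<close> at \<open>t = a * y\<close>: the plateau gives
  \<open>2 * n * k\<close>, the two cut corners together \<open>(k - s)\<^sup>2\<close>, the two
  tents \<open>k\<^sup>2\<close> and \<open>l\<^sup>2\<close>.\<close>

lemma trapezoid_sum:
  fixes a m n :: nat and k l s :: real and G :: "nat \<Rightarrow> real"
  assumes m: "m = n div a" and a: "0 < a"
    and le: "0 \<le> l" "l \<le> s" "s \<le> k" "2 * k \<le> real n + s" "k \<le> real n"
    and G: "\<And>y. y \<in> {1..m} \<Longrightarrow> G y \<le> k"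
      "\<And>y. y \<in> {1..m} \<Longrightarrow> G y \<le> s + 2 * (real a * real y)"
      "\<And>y. y \<in> {1..m} \<Longrightarrow> G y \<le> s + 2 * (real n - real a * real y)"
      "\<And>y. y \<in> {1..m} \<Longrightarrow> G y \<le> \<bar>real n - 2 * (real a * real y)\<bar>"
  shows "2 * real a * (\<Sum>y = 1..m. max (G y) l)
    \<le> 2 * real n * k - (k - s)\<^sup>2 - k\<^sup>2 + l\<^sup>2 + 12 * real a * real n + 12 * (real a)\<^sup>2"
proof -
  define H where "H = (\<Sum>y = 1..m. max 0 (k - s - 2 * real a * real y))"
  define H' where "H' = (\<Sum>y = 1..m. max 0 (k - s - 2 * (real n - real a * real y)))"
  define T where "T b = (\<Sum>y = 1..m. max 0 (b - \<bar>real n - 2 * real a * real y\<bar>))" for b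
  have ram: "real a * real m \<le> real n" "real n \<le> real a * real m + real a"
    using m real_div_bounds[OF a] by simp_all
  have "(\<Sum>y = 1..m. max (G y) l) \<le> (\<Sum>y = 1..m. k - max 0 (k - s - 2 * (real a * real y))
      - max 0 (k - s - 2 * (real n - real a * real y))
      - max 0 (k - \<bar>real n - 2 * (real a * real y)\<bar>) + max 0 (l - \<bar>real n - 2 * (real a * real y)\<bar>))"
  proof (rule sum_mono)
    fix y assume y: "y \<in> {1..m}"
    then have "real a * real y \<le> real a * real m" by (intro mult_left_mono) auto
    then show "max (G y) l \<le> k - max 0 (k - s - 2 * (real a * real y))
      - max 0 (k - s - 2 * (real n - real a * real y))
      - max 0 (k - \<bar>real n - 2 * (real a * real y)\<bar>) + max 0 (l - \<bar>real n - 2 * (real a * real y)\<bar>)"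
      using ram le G[OF y] by (intro trapezoid_bound) auto
  qed
  also have "\<dots> = real m * k - H - H' - T k + T l"
    unfolding H_def H'_def T_def by (simp add: sum.distrib sum_subtractf algebra_simps)
  finally have main: "(\<Sum>y = 1..m. max (G y) l) \<le> real m * k - H - H' - T k + T l" .
  \<comment> \<open>Reflecting \<open>y\<close> to \<open>m + 1 - y\<close> exchanges the two
    corners up to rounding. As \<open>a * (m + 1)\<close> is at least \<open>n\<close>, the rounding
    favours \<open>H'\<close>, so \<open>H + H'\<close> may be replaced by
    \<open>2 * H\<close>.\<close>
  have "H \<le> (\<Sum>y = 1..m. max 0 (k - s - 2 * (real n - real a * real (m + 1 - y))))"
    unfolding H_def
  proof (rule sum_mono)
    fix y assume "y \<in> {1..m}"
    then have "real (m + 1 - y) = real m + 1 - real y" by auto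
    then show "max 0 (k - s - 2 * real a * real y)
        \<le> max 0 (k - s - 2 * (real n - real a * real (m + 1 - y)))"
      using ram by (auto simp: algebra_simps intro!: max.mono)
  qed
  also have "\<dots> = H'"
    unfolding H'_def
    using sum.atLeastAtMost_rev[of "\<lambda>y. max 0 (k - s - 2 * (real n - real a * real y))" 1 m]
    by (simp only: add.commute)
  finally have HH: "H \<le> H'" .
  have H: "(k - s)\<^sup>2 - 4 * real a * real n - 4 * (real a)\<^sup>2 \<le> 4 * real a * H"
    unfolding H_def using le by (intro hinge_sum_lower[OF m a]) auto
  have Tk: "k\<^sup>2 - 4 * real a * real n - 4 * (real a)\<^sup>2 \<le> 2 * real a * T k"
    using tent_sum[OF m a, of k] le unfolding T_def by (simp add: abs_le_iff)
  have Tl: "2 * real a * T l \<le> l\<^sup>2 + 4 * real a * real n + 4 * (real a)\<^sup>2"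
    using tent_sum[OF m a, of l] le unfolding T_def by (simp add: abs_le_iff)
  have "2 * real a * (\<Sum>y = 1..m. max (G y) l) \<le> 2 * real a * (real m * k - H - H' - T k + T l)"
    using main by (intro mult_left_mono) auto
  also have "\<dots> = 2 * (real a * real m) * k - 2 * real a * H - 2 * real a * H' - 2 * real a * T k + 2 * real a * T l"
    by (simp add: algebra_simps)
  finally have 1: "2 * real a * (\<Sum>y = 1..m. max (G y) l) \<le> \<dots>" .
  have 2: "2 * (real a * real m) * k \<le> 2 * real n * k"
    using ram le by (intro mult_right_mono) auto
  have 3: "2 * real a * H \<le> 2 * real a * H'"
    using HH by (intro mult_left_mono) auto
  show ?thesis using 1 2 3 H Tk Tl by linarith
qed

subsection \<open>Sequences of signs\<close>

locale sign_sequence =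
  fixes f :: "nat \<Rightarrow> real"
  assumes sign: "f i = 1 \<or> f i = -1"
begin

definition P :: "nat \<Rightarrow> real" where "P k = (\<Sum>i = 1..k. f i)"

lemma P_diff: "i \<le> j \<Longrightarrow> P j - P i = (\<Sum>k = i + 1..j. f k)"
  unfolding P_def using sum.ub_add_nat[of 1 i f "j - i"] by simp

lemma sq_sign [simp]: "f i * f i = 1"
  using sign[of i] by auto

lemma abs_sign [simp]: "\<bar>f i\<bar> = 1"
  using sign[of i] by auto

lemma P_Lipschitz: "\<bar>P i - P j\<bar> \<le> \<bar>real i - real j\<bar>"
proof -
  have "\<bar>P j - P i\<bar> \<le> real j - real i" if "i \<le> j" for i j
  proof -
    have "\<bar>P j - P i\<bar> \<le> (\<Sum>k = i + 1..j. \<bar>f k\<bar>)"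
      unfolding P_diff[OF that] by (rule sum_abs)
    also have "\<dots> = real j - real i" using that by simp
    finally show ?thesis .
  qed
  from this[of i j] this[of j i] show ?thesis by linarith
qed

lemma P_le: "i \<le> j \<Longrightarrow> P j \<le> P i + (real j - real i)"
  and P_ge: "i \<le> j \<Longrightarrow> P i - (real j - real i) \<le> P j"
  using P_Lipschitz[of i j] by auto

lemma P_0 [simp]: "P 0 = 0"
  by (simp add: P_def)

text \<open>With \<open>R r\<close> the sum of \<open>f\<close> over a residue class, the sum of all
  \<open>(R r)\<^sup>2\<close> contains the diagonal once and every congruent pair
  \<open>x < z\<close> twice. Cauchy-Schwarz bounds it below by
  \<open>(P n)\<^sup>2 / a\<close>.\<close>

lemma same_residue_lower:
  assumes "0 < a"
  shows "(P n)\<^sup>2 / (2 * real a) - real n / 2 \<le>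
    (\<Sum>y = 1..n div a. \<Sum>x = 1..n - a * y. f x * f (x + a * y))"
proof -
  define N where "N = {1..n}"
  define R where "R r = (\<Sum>x \<in> {x \<in> N. x mod a = r}. f x)" for r
  have fin: "finite N" by (simp add: N_def)
  define L where "L = {p \<in> N \<times> N. fst p < snd p \<and> fst p mod a = snd p mod a}"
  have "(\<Sum>r<a. R r) = P n"
    unfolding R_def P_def using assms
    by (subst sum.group[where S = N and T = "{..<a}" and g = "\<lambda>x. x mod a"])
      (auto simp: N_def)
  moreover have "0 \<le> (\<Sum>r<a. (R r - P n / real a)\<^sup>2)"
    by (intro sum_nonneg) auto
  moreover have "(\<Sum>r<a. (R r - P n / real a)\<^sup>2) =
      (\<Sum>r<a. (R r)\<^sup>2) - 2 * (P n / real a) * (\<Sum>r<a. R r) + real a * (P n / real a)\<^sup>2"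
    by (simp add: power2_diff sum.distrib sum_subtractf sum_distrib_left sum_divide_distrib algebra_simps)
  moreover have "2 * (P n / real a) * P n - real a * (P n / real a)\<^sup>2 = (P n)\<^sup>2 / real a"
    using assms by (simp add: power2_eq_square field_simps)
  ultimately have cs: "(P n)\<^sup>2 / real a \<le> (\<Sum>r<a. (R r)\<^sup>2)"
    by simp
  have "(\<Sum>r<a. (R r)\<^sup>2) = (\<Sum>r<a. \<Sum>p \<in> {p \<in> {p \<in> N \<times> N. fst p mod a = snd p mod a}. fst p mod a = r}.
      f (fst p) * f (snd p))"
  proof (rule sum.cong)
    fix r
    have "{p \<in> {p \<in> N \<times> N. fst p mod a = snd p mod a}. fst p mod a = r}
        = {x \<in> N. x mod a = r} \<times> {x \<in> N. x mod a = r}" by auto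
    then show "(R r)\<^sup>2 = (\<Sum>p \<in> {p \<in> {p \<in> N \<times> N. fst p mod a = snd p mod a}. fst p mod a = r}.
        f (fst p) * f (snd p))"
      unfolding R_def power2_eq_square sum_product
      by (simp add: sum.cartesian_product case_prod_beta)
  qed simp
  also have "\<dots> = (\<Sum>p \<in> {p \<in> N \<times> N. fst p mod a = snd p mod a}. f (fst p) * f (snd p))"
    using fin assms by (intro sum.group) auto
  also have "{p \<in> N \<times> N. fst p mod a = snd p mod a} = (\<lambda>x. (x, x)) ` N \<union> (L \<union> prod.swap ` L)"
  proof (intro equalityI subsetI)
    fix p assume p: "p \<in> {p \<in> N \<times> N. fst p mod a = snd p mod a}"
    obtain x y where xy: "p = (x, y)" by fastforce
    consider "x = y" | "x < y" | "y < x" by linarith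
    then show "p \<in> (\<lambda>x. (x, x)) ` N \<union> (L \<union> prod.swap ` L)"
      by cases (use p in \<open>auto simp: xy L_def image_iff\<close>)
  qed (auto simp: L_def)
  also have "(\<Sum>p \<in> (\<lambda>x. (x, x)) ` N \<union> (L \<union> prod.swap ` L). f (fst p) * f (snd p))
      = (\<Sum>p \<in> (\<lambda>x. (x, x)) ` N. f (fst p) * f (snd p)) +
        ((\<Sum>p \<in> L. f (fst p) * f (snd p)) + (\<Sum>p \<in> prod.swap ` L. f (fst p) * f (snd p)))"
  proof -
    have "finite L" using fin by (simp add: L_def)
    then show ?thesis
      using fin by (subst sum.union_disjoint sum.union_disjoint[of L "prod.swap ` L"];
        (auto simp: L_def)?)+
  qed
  also have "(\<Sum>p \<in> (\<lambda>x. (x, x)) ` N. f (fst p) * f (snd p)) = real n"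
    by (subst sum.reindex) (auto simp: inj_on_def N_def)
  also have "(\<Sum>p \<in> prod.swap ` L. f (fst p) * f (snd p)) = (\<Sum>p \<in> L. f (fst p) * f (snd p))"
    by (subst sum.reindex) (auto simp: mult.commute)
  finally have sq: "(\<Sum>r<a. (R r)\<^sup>2) = real n + 2 * (\<Sum>p \<in> L. f (fst p) * f (snd p))" by simp
  \<comment> \<open>A congruent pair \<open>x < z\<close> is the same as \<open>x\<close> together
    with \<open>y = (z - x) div a\<close>.\<close>
  have "(\<Sum>p \<in> L. f (fst p) * f (snd p)) =
      (\<Sum>p \<in> Sigma {1..n div a} (\<lambda>y. {1..n - a * y}). f (snd p) * f (snd p + a * fst p))"
  proof (rule sum.reindex_bij_witness[where i = "\<lambda>p. (snd p, snd p + a * fst p)"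
        and j = "\<lambda>p. ((snd p - fst p) div a, fst p)"])
    fix p assume "p \<in> L"
    then obtain x z where xz: "p = (x, z)" "1 \<le> x" "x < z" "z \<le> n" "x mod a = z mod a"
      by (cases p) (auto simp: L_def N_def)
    then have "a dvd z - x" by (metis less_imp_le mod_eq_dvd_iff_nat)
    then obtain y where y: "z - x = a * y" by blast
    then have z: "z = x + a * y" using xz by simp
    then have "1 \<le> y" using xz by (cases y) auto
    moreover have "y \<le> n div a"
      using z xz assms by (simp add: less_eq_div_iff_mult_less_eq mult.commute)
    ultimately show "((snd p - fst p) div a, fst p) \<in> Sigma {1..n div a} (\<lambda>y. {1..n - a * y})"
      "(snd ((snd p - fst p) div a, fst p), snd ((snd p - fst p) div a, fst p)
         + a * fst ((snd p - fst p) div a, fst p)) = p"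
      "f (snd ((snd p - fst p) div a, fst p)) * f (snd ((snd p - fst p) div a, fst p)
         + a * fst ((snd p - fst p) div a, fst p)) = f (fst p) * f (snd p)"
      using xz z assms by auto
  next
    fix p assume "p \<in> Sigma {1..n div a} (\<lambda>y. {1..n - a * y})"
    then show "((snd (snd p, snd p + a * fst p) - fst (snd p, snd p + a * fst p)) div a,
        fst (snd p, snd p + a * fst p)) = p" "(snd p, snd p + a * fst p) \<in> L"
      using assms by (auto simp: L_def N_def)
  qed
  also have "\<dots> = (\<Sum>y = 1..n div a. \<Sum>x = 1..n - a * y. f x * f (x + a * y))"
    by (subst sum.Sigma) (auto simp: case_prod_beta)
  finally show ?thesis
    using sq cs assms by (simp add: field_simps)
qed

lemma inner_sum:
  assumes "a * y \<le> n"
  shows "(\<Sum>x = 1..n - a * y. f x * f y + f y * f (x + a * y)) = f y * (P n + (P (n - a * y) - P (a * y)))"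
proof -
  have "(\<Sum>x = 1..n - a * y. f (x + a * y)) = P n - P (a * y)"
    unfolding P_diff[OF assms] using assms
    by (subst sum.shift_bounds_cl_nat_ivl[symmetric]) (simp add: add.commute)
  moreover have "(\<Sum>x = 1..n - a * y. f x * f y + f y * f (x + a * y))
      = f y * (P (n - a * y) + (\<Sum>x = 1..n - a * y. f (x + a * y)))"
    by (simp add: sum.distrib P_def sum_distrib_left algebra_simps)
  ultimately show ?thesis by simp
qed

text \<open>As \<open>f\<close> sums to \<open>P m\<close> over \<open>[1,m]\<close>, replacing
  \<open>G\<close> by \<open>G - \<mu>\<close> changes the sum by exactly
  \<open>\<mu> * P m\<close>; what remains is bounded termwise by absolute values.\<close>

lemma signed_sum_lower:
  fixes a n :: nat and \<mu> :: real
  assumes "0 < a"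
  defines "G \<equiv> \<lambda>y. P (n - a * y) - P (a * y)" and "m \<equiv> n div a"
  shows "\<mu> * P m - (\<Sum>y = 1..m. max \<bar>G y\<bar> \<bar>\<mu>\<bar>) - real a * real m \<le> (\<Sum>y = 1..m. f y * G y)"
proof -
  \<comment> \<open>\<open>G (m + 1 - y)\<close> equals \<open>- G y\<close> up to \<open>2 * a\<close>, and \<open>\<bar>g - \<mu>\<bar> + \<bar>- g - \<mu>\<bar> = 2 * max \<bar>g\<bar> \<bar>\<mu>\<bar>\<close>.\<close>
  have "\<bar>G y - \<mu>\<bar> + \<bar>G (m + 1 - y) - \<mu>\<bar> \<le> 2 * max \<bar>G y\<bar> \<bar>\<mu>\<bar> + 2 * real a" if "y \<in> {1..m}" for y
  proof -
    have le: "a * y' \<le> n" if "y' \<le> m" for y'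
    proof -
      have "a * y' \<le> a * m" using that by simp
      also have "\<dots> \<le> n" by (simp add: m_def)
      finally show ?thesis .
    qed
    have r: "real (n - a * y) = real n - real a * real y"
        "real (n - a * (m + 1 - y)) = real n - real a * real (m + 1 - y)"
      using le[of y] le[of "m + 1 - y"] that by (auto simp: of_nat_diff)
    have r': "real a * real (m + 1 - y) = real a * real m + real a - real a * real y"
      using that by (subst of_nat_diff) (auto simp: algebra_simps)
    \<comment> \<open>\<open>a * (m + 1)\<close> lies between \<open>n\<close> and
      \<open>n + a\<close>, so reflected positions differ by at most \<open>a\<close> and the
      Lipschitz bound applies to each.\<close>
    have "\<bar>real (n - a * (m + 1 - y)) - real (a * y)\<bar> \<le> real a"
      "\<bar>real (n - a * y) - real (a * (m + 1 - y))\<bar> \<le> real a"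
      using real_div_bounds[OF assms(1), of n, folded m_def]
      unfolding r of_nat_mult r' by linarith+
    then have "\<bar>P (n - a * (m + 1 - y)) - P (a * y)\<bar> \<le> real a"
      "\<bar>P (n - a * y) - P (a * (m + 1 - y))\<bar> \<le> real a"
      by (auto intro: order_trans[OF P_Lipschitz])
    then have "\<bar>G y + G (m + 1 - y)\<bar> \<le> 2 * real a"
      unfolding G_def by (simp add: abs_le_iff)
    then show ?thesis by linarith
  qed
  then have "(\<Sum>y = 1..m. \<bar>G y - \<mu>\<bar> + \<bar>G (m + 1 - y) - \<mu>\<bar>) \<le> (\<Sum>y = 1..m. 2 * max \<bar>G y\<bar> \<bar>\<mu>\<bar> + 2 * real a)"
    by (rule sum_mono)
  moreover have "(\<Sum>y = 1..m. \<bar>G (m + 1 - y) - \<mu>\<bar>) = (\<Sum>y = 1..m. \<bar>G y - \<mu>\<bar>)"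
    using sum.atLeastAtMost_rev[of "\<lambda>y. \<bar>G y - \<mu>\<bar>" 1 m] by (simp only: add.commute)
  ultimately have abs_sum: "(\<Sum>y = 1..m. \<bar>G y - \<mu>\<bar>) \<le> (\<Sum>y = 1..m. max \<bar>G y\<bar> \<bar>\<mu>\<bar>) + real a * real m"
    by (simp add: sum.distrib algebra_simps flip: sum_distrib_left)
  have "- (\<Sum>y = 1..m. \<bar>G y - \<mu>\<bar>) = (\<Sum>y = 1..m. - \<bar>f y * (G y - \<mu>)\<bar>)"
    by (simp add: abs_mult sum_negf)
  also have "\<dots> \<le> (\<Sum>y = 1..m. f y * (G y - \<mu>))"
    by (intro sum_mono) linarith
  also have "\<dots> = (\<Sum>y = 1..m. f y * G y) - \<mu> * P m"
    by (simp add: P_def right_diff_distrib sum_subtractf sum_distrib_left mult.commute)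
  finally show ?thesis using abs_sum by linarith
qed

text \<open>
  If \<open>f = 1\<close> encodes red, then \<open>real n - real m - P m\<close> is \<open>n\<close> minus twice the number of red elements of \<open>[1,m]\<close>.
\<close>

lemma window_bound:
  assumes "P n \<le> 0" "2 * m \<le> n" "k \<le> n"
  shows "\<bar>P (n - k) - P k\<bar> \<le> real n - real m - P m"
proof -
  \<comment> \<open>The left side is invariant under \<open>k \<mapsto> n - k\<close>. For
    \<open>k \<le> m\<close> both signs are estimated by passing through \<open>P m\<close>, one of
    them using \<open>P n \<le> 0\<close>; for \<open>k > m\<close> the window from
    \<open>k + 1\<close> to \<open>n - k\<close> is shorter than \<open>n - 2 * m\<close>.\<close>
  have *: "\<bar>P (n - k) - P k\<bar> \<le> real n - real m - P m" if k: "2 * k \<le> n" for k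
  proof (cases "k \<le> m")
    case True
    have "real (n - k) = real n - real k" "m \<le> n - k" using k assms True by auto
    then show ?thesis
      using True assms P_ge[of m "n - k"] P_le[of 0 k] P_ge[of "n - k" n] P_ge[of k m] P_le[of k m] k
      by (simp add: abs_le_iff)
  next
    case False
    have "real (n - k) = real n - real k" using k by auto
    then show ?thesis
      using False assms P_Lipschitz[of k "n - k"] P_le[of 0 m] k by simp
  qed
  show ?thesis
  proof (cases "2 * k \<le> n")
    case False
    then show ?thesis
      using *[of "n - k"] assms by (simp add: abs_minus_commute)
  qed (rule *)
qed

end

section \<open>Minimization of the quadratic form\<close>

text \<open>
  Up to a factor 2 the three coordinates on the plane are \<open>s - E\<close>, \<open>n - k\<close> and \<open>k - s\<close>.
  If \<open>E > s\<close> the first square is lost, but then \<open>s - E < 0\<close> may be dropped from the plane as well.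
\<close>

lemma quadratic_lower:
  fixes A n s E k :: real
  assumes A: "2 \<le> A" "A \<le> n" and s: "0 \<le> s" "s \<le> k" "2 * k \<le> n + s"
    and E: "E \<le> A * (n - k) - n + A"
  defines "l \<equiv> min \<bar>E\<bar> s"
  shows "4 * n\<^sup>2 / (A\<^sup>2 + 2 * A + 3) - A * n \<le>
    n\<^sup>2 + s\<^sup>2 - 2 * s * E + 2 * l * \<bar>E\<bar> - 2 * n * k + (k - s)\<^sup>2 + k\<^sup>2 - l\<^sup>2"
proof -
  define D where "D = A\<^sup>2 + 2 * A + 3"
  define F where "F = n\<^sup>2 + s\<^sup>2 - 2 * s * E + 2 * l * \<bar>E\<bar> - 2 * n * k + (k - s)\<^sup>2 + k\<^sup>2 - l\<^sup>2"
  have "2\<^sup>2 \<le> A\<^sup>2" using A by (intro power_mono) auto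
  then have D: "11 \<le> D" using A by (simp add: D_def)
  have F: "F = (n - k)\<^sup>2 + (k - s)\<^sup>2 + (s\<^sup>2 - 2 * s * E + 2 * l * \<bar>E\<bar> - l\<^sup>2)"
    by (simp add: F_def power2_eq_square algebra_simps)
  have cauchy: "4 * n\<^sup>2 - 4 * A * n \<le> D * ((n - k)\<^sup>2 + (k - s)\<^sup>2 + u\<^sup>2)"
    if u: "2 * n - A \<le> u + (k - s) + (A + 1) * (n - k)" for u
  proof -
    have "(2 * n - A)\<^sup>2 \<le> (u + (k - s) + (A + 1) * (n - k))\<^sup>2"
      using A u by (intro power_mono) auto
    \<comment> \<open>Lagrange's identity for the vector with entries \<open>1\<close>,
      \<open>1\<close>, \<open>A + 1\<close>, whose squared norm is \<open>D\<close>.\<close>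
    also have "\<dots> = D * ((n - k)\<^sup>2 + (k - s)\<^sup>2 + u\<^sup>2) - (u - (k - s))\<^sup>2
        - ((A + 1) * u - (n - k))\<^sup>2 - ((A + 1) * (k - s) - (n - k))\<^sup>2"
      by (simp add: D_def power2_eq_square algebra_simps)
    also have "\<dots> \<le> D * ((n - k)\<^sup>2 + (k - s)\<^sup>2 + u\<^sup>2)"
      using zero_le_power2[of "u - (k - s)"] zero_le_power2[of "(A + 1) * u - (n - k)"]
        zero_le_power2[of "(A + 1) * (k - s) - (n - k)"] by linarith
    finally have "(2 * n - A)\<^sup>2 \<le> D * ((n - k)\<^sup>2 + (k - s)\<^sup>2 + u\<^sup>2)" .
    moreover have "4 * n\<^sup>2 - 4 * A * n \<le> (2 * n - A)\<^sup>2"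
      by (simp add: power2_eq_square algebra_simps)
    ultimately show ?thesis by linarith
  qed
  have E': "2 * n - A \<le> (s - E) + (k - s) + (A + 1) * (n - k)"
    using E by (simp add: algebra_simps)
  have "4 * n\<^sup>2 - 4 * A * n \<le> D * F"
  proof (cases "\<bar>E\<bar> \<le> s")
    case True
    then have "F = (n - k)\<^sup>2 + (k - s)\<^sup>2 + (s - E)\<^sup>2"
      unfolding F l_def by (simp add: power2_eq_square algebra_simps min_def abs_if)
    then show ?thesis using cauchy[OF E'] by simp
  next
    case False
    then have l: "l = s" by (simp add: l_def)
    show ?thesis
    proof (cases "0 \<le> E")
      case True
      then have "F = (n - k)\<^sup>2 + (k - s)\<^sup>2 + 0\<^sup>2"
        unfolding F l by (simp add: power2_eq_square)
      then show ?thesis using cauchy[of 0] E' False True by simp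
    next
      case neg: False
      \<comment> \<open>Here \<open>E < - s\<close>, and the last bracket of \<open>F\<close> is at
        least \<open>4 * s\<^sup>2\<close>. Minimizing over \<open>k\<close> and then over
        \<open>s\<close> (at \<open>s = n / 9\<close>) gives \<open>4 * n\<^sup>2 / 9\<close>, which
        suffices because \<open>D\<close> exceeds 9.\<close>
      have "s * s \<le> s * \<bar>E\<bar>" using False s by (intro mult_left_mono) auto
      then have "(n - k)\<^sup>2 + (k - s)\<^sup>2 + 4 * s\<^sup>2 \<le> F"
        unfolding F l using neg by (simp add: power2_eq_square mult.commute)
      moreover have "2 * ((n - k)\<^sup>2 + (k - s)\<^sup>2) = (n - s)\<^sup>2 + (n - 2 * k + s)\<^sup>2"
        by (simp add: power2_eq_square algebra_simps)
      then have "(n - s)\<^sup>2 \<le> 2 * ((n - k)\<^sup>2 + (k - s)\<^sup>2)" by simp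
      ultimately have "(n - s)\<^sup>2 / 2 + 4 * s\<^sup>2 \<le> F" by argo
      have "9 * ((n - s)\<^sup>2 / 2 + 4 * s\<^sup>2) = 4 * n\<^sup>2 + (n - 9 * s)\<^sup>2 / 2"
        by (simp add: power2_eq_square field_simps)
      then have "4 * n\<^sup>2 \<le> 9 * ((n - s)\<^sup>2 / 2 + 4 * s\<^sup>2)" by simp
      also have "\<dots> \<le> 9 * F"
        using \<open>(n - s)\<^sup>2 / 2 + 4 * s\<^sup>2 \<le> F\<close> by (rule mult_left_mono) simp
      finally have F9: "4 * n\<^sup>2 \<le> 9 * F" .
      then have "0 \<le> F" using zero_le_power2[of n] by linarith
      then have "9 * F \<le> D * F" using D by (intro mult_right_mono) auto
      moreover have "0 \<le> A * n" using A by simp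
      ultimately show ?thesis using F9 by linarith
    qed
  qed
  then have "4 * n\<^sup>2 / D \<le> F + 4 * A * n / D"
    using D by (simp add: field_simps)
  moreover have "4 * A * n / D \<le> A * n"
    using D A by (simp add: field_simps)
  ultimately show ?thesis unfolding F_def D_def by linarith
qed

text \<open>The sum counts the pairs of positive integers with \<open>x + a * y \<le> n\<close>;
  both the upper and the lower bound start from this exact value.\<close>

lemma progression_sum:
  fixes a n :: nat
  defines "m \<equiv> n div a"
  shows "2 * real a * (\<Sum>y = 1..m. real (n - a * y)) =
    2 * real n * (real a * real m) - real a * (real a * real m) - (real a * real m)\<^sup>2"
proof -
  have "2 * real a * (\<Sum>y = 1..k. real (n - a * y)) =
      2 * real n * (real a * real k) - real a * (real a * real k) - (real a * real k)\<^sup>2"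
    if "k \<le> m" for k
    using that
  proof (induction k)
    case (Suc k)
    have "a * Suc k \<le> a * m" using Suc.prems by (intro mult_le_mono2)
    also have "\<dots> \<le> n" by (simp add: m_def)
    finally have "real (n - a * Suc k) = real n - real a - real a * real k"
      by (simp add: algebra_simps)
    then have "(\<Sum>y = 1..Suc k. real (n - a * y))
        = (\<Sum>y = 1..k. real (n - a * y)) + (real n - real a - real a * real k)"
      by simp
    then show ?case
      using Suc.IH Suc.prems by (simp only: distrib_left) (simp add: power2_eq_square algebra_simps)
  qed simp
  then show ?thesis by blast
qed

section \<open>Lower bound for one sequence of signs\<close>

context sign_sequence
begin

text \<open>The summand is 4 if the three signs agree and 0 otherwise, so this is four times the
  number of monochromatic triples.\<close>

definition signed_count :: "nat \<Rightarrow> nat \<Rightarrow> real" where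
  "signed_count a n = (\<Sum>y = 1..n div a. \<Sum>x = 1..n - a * y.
     1 + f x * f y + f y * f (x + a * y) + f x * f (x + a * y))"

lemma signed_count_lower:
  assumes a: "2 \<le> a" "a \<le> n" and neg: "P n \<le> 0"
  shows "4 * (real n)\<^sup>2 / ((real a)\<^sup>2 + 2 * real a + 3) - 17 * real a * real n - 12 * (real a)\<^sup>2
    \<le> 2 * real a * signed_count a n"
proof -
  define m where "m = n div a"
  define G where "G y = P (n - a * y) - P (a * y)" for y
  define s where "s = - P n"
  define \<kappa> where "\<kappa> = real n - real m - P m"
  \<comment> \<open>\<open>(n + s) / 2\<close> is the height where the slopes
    \<open>s + 2 * t\<close> and \<open>s + 2 * (n - t)\<close> meet
    \<open>\<bar>n - 2 * t\<bar>\<close>, so it bounds \<open>\<bar>G y\<bar>\<close> as well and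
    secures \<open>2 * k \<le> n + s\<close>.\<close>
  define k where "k = min \<kappa> ((real n + s) / 2)"
  define E where "E = real a * P m"
  \<comment> \<open>The final form contains \<open>2 * l * \<bar>E\<bar> - l\<^sup>2\<close>, which
    is largest at \<open>l = \<bar>E\<bar>\<close>; the trapezoid estimate demands
    \<open>l \<le> s\<close>.\<close>
  define l where "l = min \<bar>E\<bar> s"
  define \<mu> where "\<mu> = l * sgn E"
  have a0: "0 < a" using a by simp
  note am = real_div_bounds[OF a0, of n, folded m_def]
  have le: "a * y \<le> n" if "y \<le> m" for y
  proof -
    have "a * y \<le> a * m" using that by simp
    also have "\<dots> \<le> n" by (simp add: m_def)
    finally show ?thesis .
  qed
  have "2 * m \<le> a * m" using a by (intro mult_le_mono1)
  then have m2: "2 * m \<le> n" using le[of m] by linarith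
  have s: "0 \<le> s" "s \<le> real n" "s \<le> \<kappa>" "\<kappa> \<le> real n"
    using neg P_ge[of 0 n] P_ge[of m n] P_ge[of 0 m] m2 by (simp_all add: s_def \<kappa>_def)
  have k: "s \<le> k" "2 * k \<le> real n + s" "k \<le> real n" "k \<le> \<kappa>"
    using s by (auto simp: k_def min_def)
  have l: "0 \<le> l" "l \<le> s" using s by (auto simp: l_def)
  have \<mu>: "\<bar>\<mu>\<bar> = l" "\<mu> * E = l * \<bar>E\<bar>"
    using s by (auto simp: \<mu>_def l_def sgn_if abs_mult)
  have G: "\<bar>G y\<bar> \<le> k" "\<bar>G y\<bar> \<le> s + 2 * (real a * real y)"
    "\<bar>G y\<bar> \<le> s + 2 * (real n - real a * real y)" "\<bar>G y\<bar> \<le> \<bar>real n - 2 * (real a * real y)\<bar>"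
    if y: "y \<in> {1..m}" for y
  proof -
    define t where "t = a * y"
    have t: "t \<le> n" "real (n - t) = real n - real t" "real t = real a * real y"
      using le[of y] y by (auto simp: t_def)
    have Gt: "G y = P (n - t) - P t" by (simp add: G_def t_def)
    have 1: "\<bar>G y\<bar> \<le> \<kappa>"
      unfolding Gt \<kappa>_def using neg m2 t(1) by (rule window_bound)
    have n1: "\<bar>P (n - t) - P n\<bar> \<le> real t" and n2: "\<bar>P (n - t)\<bar> \<le> real n - real t"
      and t1: "\<bar>P t\<bar> \<le> real t" and t2: "\<bar>P t - P n\<bar> \<le> real n - real t"
      using P_Lipschitz[of "n - t" n] P_Lipschitz[of "n - t" 0] P_Lipschitz[of t 0]
        P_Lipschitz[of t n] t by auto
    show 2: "\<bar>G y\<bar> \<le> s + 2 * (real a * real y)"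
      unfolding Gt t(3)[symmetric] s_def using n1 t1 neg by linarith
    show 3: "\<bar>G y\<bar> \<le> s + 2 * (real n - real a * real y)"
      unfolding Gt t(3)[symmetric] s_def using n2 t2 neg by (simp add: abs_le_iff)
    show 4: "\<bar>G y\<bar> \<le> \<bar>real n - 2 * (real a * real y)\<bar>"
      unfolding Gt t(3)[symmetric] using P_Lipschitz[of "n - t" t] t(2) by simp
    show "\<bar>G y\<bar> \<le> k"
      using 1 2 3 4 unfolding k_def by (simp add: min_def abs_if split: if_splits)
  qed
  define third where "third = (\<Sum>y = 1..m. \<Sum>x = 1..n - a * y. f x * f (x + a * y))"
  have "signed_count a n = (\<Sum>y = 1..m. real (n - a * y) + f y * (P n + G y)
      + (\<Sum>x = 1..n - a * y. f x * f (x + a * y)))"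
    unfolding signed_count_def m_def[symmetric]
  proof (rule sum.cong)
    fix y assume "y \<in> {1..m}"
    then have "(\<Sum>x = 1..n - a * y. f x * f y + f y * f (x + a * y)) = f y * (P n + G y)"
      unfolding G_def using le[of y] by (intro inner_sum) auto
    then show "(\<Sum>x = 1..n - a * y. 1 + f x * f y + f y * f (x + a * y) + f x * f (x + a * y))
        = real (n - a * y) + f y * (P n + G y) + (\<Sum>x = 1..n - a * y. f x * f (x + a * y))"
      by (simp add: sum.distrib)
  qed simp
  also have "\<dots> = (\<Sum>y = 1..m. real (n - a * y)) + (\<Sum>y = 1..m. f y * P n)
      + (\<Sum>y = 1..m. f y * G y) + third"
    by (simp add: sum.distrib distrib_left third_def)
  also have "(\<Sum>y = 1..m. f y * P n) = P m * P n"
    by (simp add: P_def sum_distrib_right)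
  finally have split: "2 * real a * signed_count a n = 2 * real a * (\<Sum>y = 1..m. real (n - a * y))
      - 2 * s * E + 2 * real a * (\<Sum>y = 1..m. f y * G y) + 2 * real a * third"
    by (simp add: s_def E_def algebra_simps)
  define u where "u = real a * real m"
  have u: "0 \<le> u" "u \<le> real n" "real n \<le> u + real a" using am by (simp_all add: u_def)
  \<comment> \<open>The progression sum equals \<open>n\<^sup>2 - (n - u)\<^sup>2 - a * u\<close>,
    so with this inequality rounding costs at most \<open>a * n\<close>.\<close>
  have "(real n - u) * (real n - u) \<le> real a * (real n - u)"
    using u by (intro mult_right_mono) auto
  then have first: "(real n)\<^sup>2 - real a * real n \<le> 2 * real a * (\<Sum>y = 1..m. real (n - a * y))"
    unfolding m_def progression_sum unfolding m_def[symmetric] u_def[symmetric]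
    by (simp add: power2_eq_square algebra_simps)
  have third: "s\<^sup>2 - real a * real n \<le> 2 * real a * third"
  proof -
    have "(P n)\<^sup>2 / (2 * real a) - real n / 2 \<le> third"
      unfolding third_def m_def by (rule same_residue_lower[OF a0])
    then show ?thesis using a0 by (simp add: s_def field_simps)
  qed
  have "2 * real a * (\<mu> * P m - (\<Sum>y = 1..m. max \<bar>G y\<bar> \<bar>\<mu>\<bar>) - real a * real m)
      \<le> 2 * real a * (\<Sum>y = 1..m. f y * G y)"
    unfolding G_def m_def by (intro mult_left_mono signed_sum_lower a0) auto
  moreover have "real a * (real a * real m) \<le> real a * real n"
    using am by (intro mult_left_mono) auto
  moreover have "2 * real a * (\<mu> * P m) = 2 * l * \<bar>E\<bar>"
    using \<mu>(2) by (simp add: E_def algebra_simps)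
  moreover have "2 * real a * (\<Sum>y = 1..m. max \<bar>G y\<bar> l) \<le> 2 * real n * k - (k - s)\<^sup>2 - k\<^sup>2 + l\<^sup>2
      + 12 * real a * real n + 12 * (real a)\<^sup>2"
    using k l G by (intro trapezoid_sum[OF m_def a0]) auto
  ultimately have second: "2 * l * \<bar>E\<bar> - (2 * real n * k - (k - s)\<^sup>2 - k\<^sup>2 + l\<^sup>2
      + 12 * real a * real n + 12 * (real a)\<^sup>2) - 2 * real a * real n
      \<le> 2 * real a * (\<Sum>y = 1..m. f y * G y)"
    unfolding \<mu>(1) by (simp add: right_diff_distrib)
  \<comment> \<open>\<open>k \<le> \<kappa>\<close> limits \<open>P m\<close>; multiplied by
    \<open>a\<close>, this becomes the linear constraint that defines the plane.\<close>
  have "real a * k \<le> real a * \<kappa>" using k by (intro mult_left_mono) auto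
  then have "E \<le> real a * (real n - k) - real n + real a"
    using u unfolding E_def \<kappa>_def u_def by (simp add: algebra_simps)
  then have "4 * (real n)\<^sup>2 / ((real a)\<^sup>2 + 2 * real a + 3) - real a * real n \<le>
      (real n)\<^sup>2 + s\<^sup>2 - 2 * s * E + 2 * l * \<bar>E\<bar> - 2 * real n * k + (k - s)\<^sup>2 + k\<^sup>2 - l\<^sup>2"
    unfolding l_def using a s k by (intro quadratic_lower) auto
  then show ?thesis
    using split first second third by linarith
qed

end

subsection \<open>Counting monochromatic triples\<close>

text \<open>\<open>y\<close> comes first because the range of \<open>x\<close> depends on it; this
  matches the double sum in \<open>signed_count\<close>.\<close>

definition pairs :: "nat \<Rightarrow> nat \<Rightarrow> (nat \<times> nat) set" where
  "pairs a n = Sigma {1..n div a} (\<lambda>y. {1..n - a * y})"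

lemma finite_pairs: "finite (pairs a n)"
  by (simp add: pairs_def)

lemma mem_pairs_iff:
  assumes "0 < a"
  shows "(y, x) \<in> pairs a n \<longleftrightarrow> 1 \<le> x \<and> 1 \<le> y \<and> x + a * y \<le> n"
proof -
  have "y \<le> n div a \<longleftrightarrow> a * y \<le> n"
    using assms by (simp add: less_eq_div_iff_mult_less_eq mult.commute)
  then show ?thesis by (auto simp: pairs_def)
qed

lemma card_pairs_le: "2 * real a * real (card (pairs a n)) \<le> (real n)\<^sup>2"
proof -
  define u where "u = real a * real (n div a)"
  have "card (pairs a n) = (\<Sum>y = 1..n div a. n - a * y)"
    by (simp add: pairs_def)
  then have "2 * real a * real (card (pairs a n)) = 2 * real n * u - real a * u - u\<^sup>2"
    using progression_sum[of a n, folded u_def] by simp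
  also have "\<dots> = (real n)\<^sup>2 - (real n - u)\<^sup>2 - real a * u"
    by (simp add: power2_eq_square algebra_simps)
  also have "\<dots> \<le> (real n)\<^sup>2"
  proof -
    have "0 \<le> real a * u" by (simp add: u_def)
    then show ?thesis using zero_le_power2[of "real n - u"] by linarith
  qed
  finally show ?thesis .
qed

definition sgn_color :: "color \<Rightarrow> real" where
  "sgn_color c = (case c of Red \<Rightarrow> 1 | Blue \<Rightarrow> -1)"

text \<open>A triple is determined by \<open>y\<close> and \<open>x\<close>, and the pairwise
  products of three signs add up to 3 if all agree and to -1 otherwise.\<close>

lemma card_mono_triples:
  assumes "0 < a"
  shows "4 * real (card (mono_triples a n c)) = (\<Sum>(y, x) \<in> pairs a n.
    1 + sgn_color (c x) * sgn_color (c y) + sgn_color (c y) * sgn_color (c (x + a * y))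
      + sgn_color (c x) * sgn_color (c (x + a * y)))"
proof -
  define M where "M = {p \<in> pairs a n. c (snd p) = c (fst p) \<and> c (fst p) = c (snd p + a * fst p)}"
  have "mono_triples a n c = (\<lambda>(y, x). (x, y, x + a * y)) ` M"
  proof (intro equalityI subsetI)
    fix t assume "t \<in> mono_triples a n c"
    then obtain x y where t: "t = (x, y, x + a * y)" "1 \<le> x" "1 \<le> y" "x + a * y \<le> n"
      "c x = c y" "c y = c (x + a * y)"
      by (auto simp: mono_triples_def)
    then have "(y, x) \<in> M" using assms by (simp add: M_def mem_pairs_iff)
    then show "t \<in> (\<lambda>(y, x). (x, y, x + a * y)) ` M" unfolding t(1) by force
  next
    fix t assume "t \<in> (\<lambda>(y, x). (x, y, x + a * y)) ` M"
    then obtain x y where t: "t = (x, y, x + a * y)" and M: "(y, x) \<in> M" by auto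
    have "y \<le> a * y" using assms by simp
    also have "a * y \<le> n" using M assms by (simp add: M_def mem_pairs_iff)
    finally show "t \<in> mono_triples a n c"
      using M assms unfolding t mono_triples_def M_def by (auto simp: mem_pairs_iff)
  qed
  then have "card (mono_triples a n c) = card M"
    by (simp add: card_image inj_on_def split_beta prod_eq_iff)
  then have "4 * real (card (mono_triples a n c)) = (\<Sum>p \<in> M. 4)" by simp
  also have "\<dots> = (\<Sum>p \<in> pairs a n.
      if c (snd p) = c (fst p) \<and> c (fst p) = c (snd p + a * fst p) then 4 else 0)"
    unfolding M_def by (rule sum.inter_filter[OF finite_pairs])
  also have "\<dots> = (\<Sum>(y, x) \<in> pairs a n.
    1 + sgn_color (c x) * sgn_color (c y) + sgn_color (c y) * sgn_color (c (x + a * y))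
      + sgn_color (c x) * sgn_color (c (x + a * y)))"
    by (intro sum.cong) (auto simp: sgn_color_def split: color.splits)
  finally show ?thesis .
qed

text \<open>Swapping the colors negates \<open>P n\<close> but preserves the signed count, so
  \<open>P n \<le> 0\<close> may be assumed.\<close>

lemma card_mono_triples_lower:
  assumes "2 \<le> a" "a \<le> n"
  shows "4 * (real n)\<^sup>2 / ((real a)\<^sup>2 + 2 * real a + 3) - 17 * real a * real n - 12 * (real a)\<^sup>2
    \<le> 8 * real a * real (card (mono_triples a n c))"
proof -
  define f where "f i = sgn_color (c i)" for i
  interpret pos: sign_sequence f
    by unfold_locales (auto simp: f_def sgn_color_def split: color.splits)
  interpret neg: sign_sequence "\<lambda>i. - f i"
    by unfold_locales (auto simp: f_def sgn_color_def split: color.splits)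
  have count: "4 * real (card (mono_triples a n c)) = pos.signed_count a n"
    using assms unfolding pos.signed_count_def
    by (subst card_mono_triples) (simp_all add: pairs_def sum.Sigma f_def)
  have flip: "neg.signed_count a n = pos.signed_count a n"
    by (simp add: neg.signed_count_def pos.signed_count_def)
  have "neg.P n = - pos.P n"
    by (simp add: neg.P_def pos.P_def sum_negf)
  then have "pos.P n \<le> 0 \<or> neg.P n \<le> 0" by linarith
  then show ?thesis
    using pos.signed_count_lower[OF assms] neg.signed_count_lower[OF assms]
    unfolding flip count[symmetric] by (auto simp: mult.assoc mult.left_commute)
qed

section \<open>Upper bound by an explicit coloring\<close>

lemma card_mono_triples_upper:
  assumes "2 \<le> a"
  obtains c where "c \<in> colorings n"
    and "2 * real a * real (card (mono_triples a n c)) \<le>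
      (real n)\<^sup>2 / ((real a)\<^sup>2 + 2 * real a + 3) + 2 * (real a + 2) * real n + (real a + 2)\<^sup>2"
proof -
  define D where "D = a\<^sup>2 + 2 * a + 3"
  define p where "p = (a + 1) * n div D"
  define w where "w = n div D"
  define q where "q = n - w"
  \<comment> \<open>Shifting a blue triple down by \<open>p\<close> in \<open>x\<close> and
    \<open>y\<close> lowers \<open>x + a * y\<close> by \<open>(a + 1) * p\<close>, so
    \<open>u\<close> is the room left below \<open>q\<close>.\<close>
  define u where "u = q - (a + 1) * p"
  define c where "c = (\<lambda>i \<in> {1..n}. if i \<le> p \<or> q < i then Red else Blue)"
  have a0: "0 < a" using assms by simp
  have "2\<^sup>2 \<le> a\<^sup>2" using assms by (rule power_mono) simp
  then have D: "11 \<le> D" using assms by (simp add: D_def)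
  have Dp: "D * p \<le> (a + 1) * n" and Dw: "D * w \<le> n"
    by (simp_all add: p_def w_def)
  have "11 * w \<le> D * w" using D by (intro mult_le_mono1)
  then have w: "2 * w \<le> n" "w \<le> n" using Dw by linarith+
  have "D * ((a + 1) * p) \<le> (a + 1) * ((a + 1) * n)"
    using mult_le_mono2[OF Dp, of "a + 1"] by (simp add: algebra_simps)
  then have "D * ((a + 1) * p + w) \<le> D * n"
    using Dw by (simp add: D_def power2_eq_square algebra_simps)
  then have "(a + 1) * p + w \<le> n" using D by simp
  then have pq: "(a + 1) * p \<le> q" by (simp add: q_def)
  \<comment> \<open>The families are: all three in the lower red block; \<open>y\<close> in the
    lower and \<open>x\<close>, \<open>z\<close> in the upper red block; all three blue.\<close>
  have "mono_triples a n c \<subseteq> (\<lambda>(y, x). (x, y, x + a * y)) ` pairs a p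
      \<union> (\<lambda>(y, x). (x + q, y, x + q + a * y)) ` pairs a w
      \<union> (\<lambda>(y, x). (x + p, y + p, x + p + a * (y + p))) ` pairs a u" (is "_ \<subseteq> ?A \<union> ?B \<union> ?C")
  proof
    fix t assume "t \<in> mono_triples a n c"
    then obtain x y z where t: "t = (x, y, z)" "1 \<le> x" "1 \<le> y" "z = x + a * y" "z \<le> n"
      "x \<le> n" "y \<le> n" "c x = c y" "c y = c z"
      by (auto simp: mono_triples_def)
    show "t \<in> ?A \<union> ?B \<union> ?C"
    proof (cases "c x")
      case Red
      have "c y = Red" "c z = Red" using Red t by simp_all
      then have xr: "x \<le> p \<or> q < x" and yr: "y \<le> p \<or> q < y" and zr: "z \<le> p \<or> q < z"
        using Red t by (auto simp: c_def split: if_splits)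
      \<comment> \<open>\<open>y\<close> is at most \<open>n / 2\<close>, hence never in the upper
        red block.\<close>
      have "2 * y \<le> a * y" using assms by (intro mult_le_mono1)
      then have "2 * y \<le> n" using t(4,5) by linarith
      then have y: "y \<le> p" using yr w t(2-5) \<open>2 * y \<le> a * y\<close> unfolding q_def by linarith
      show ?thesis
      proof (cases "z \<le> p")
        case True
        then have "(y, x) \<in> pairs a p" using t a0 by (simp add: mem_pairs_iff)
        then show ?thesis using t by force
      next
        case False
        have "\<not> x \<le> p"
        proof
          assume "x \<le> p"
          then have "z \<le> p + a * p" using y t by (auto intro: add_mono)
          then show False using False zr pq by simp
        qed
        then have "q < x" using xr by simp
        then have "(y, x - q) \<in> pairs a w" "x = (x - q) + q"
          using t w a0 by (auto simp: mem_pairs_iff q_def)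
        then show ?thesis using t(1,4) by (auto simp: image_iff intro!: bexI[of _ "(y, x - q)"])
      qed
    next
      case Blue
      have "c y = Blue" "c z = Blue" using Blue t by simp_all
      then have b: "p < x" "p < y" "z \<le> q"
        using Blue t by (auto simp: c_def split: if_splits)
      then have "x = (x - p) + p" "y = (y - p) + p" "1 \<le> x - p" "1 \<le> y - p" by auto
      then obtain x' y' where xy: "x = x' + p" "y = y' + p" "1 \<le> x'" "1 \<le> y'" by blast
      then have "(y', x') \<in> pairs a u"
        using b t a0 by (simp add: mem_pairs_iff u_def algebra_simps)
      then show ?thesis using t(1,4) xy by force
    qed
  qed
  then have "card (mono_triples a n c) \<le> card (?A \<union> ?B \<union> ?C)"
    by (intro card_mono) (auto simp: finite_pairs)
  also have "\<dots> \<le> card ?A + card ?B + card ?C"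
    by (meson add_le_mono1 card_Un_le order_trans)
  also have "\<dots> \<le> card (pairs a p) + card (pairs a w) + card (pairs a u)"
    by (intro add_mono card_image_le finite_pairs)
  finally have "real (card (mono_triples a n c))
      \<le> real (card (pairs a p)) + real (card (pairs a w)) + real (card (pairs a u))"
    by (metis of_nat_add of_nat_le_iff)
  then have "2 * real a * real (card (mono_triples a n c))
      \<le> 2 * real a * (real (card (pairs a p)) + real (card (pairs a w)) + real (card (pairs a u)))"
    by (intro mult_left_mono) auto
  also have "\<dots> \<le> (real p)\<^sup>2 + (real w)\<^sup>2 + (real u)\<^sup>2"
    using card_pairs_le[of a p] card_pairs_le[of a w] card_pairs_le[of a u]
    by (simp add: distrib_left)
  also have "\<dots> \<le> (real n)\<^sup>2 / real D + 2 * (real a + 2) * real n + (real a + 2)\<^sup>2"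
  proof -
    define N where "N = real n / real D"
    have N: "0 \<le> N" "N \<le> real n" "real D * N = real n"
      using D by (auto simp: N_def divide_le_eq mult_le_cancel_left1)
    have rD: "real D = (real a)\<^sup>2 + 2 * real a + 3" by (simp add: D_def)
    have p: "real p \<le> (real a + 1) * N" "(real a + 1) * N \<le> real p + 1"
      using real_div_bounds[of D "(a + 1) * n"] D unfolding p_def N_def by (simp_all add: field_simps)
    have w: "real w \<le> N" "N \<le> real w + 1"
      using real_div_bounds[of D n] D unfolding w_def N_def by (simp_all add: field_simps)
    \<comment> \<open>The ideal lengths are \<open>(a + 1) * N\<close>, \<open>N\<close>,
      \<open>N\<close>, with squares adding up to \<open>D * N\<^sup>2\<close>. Rounding
      \<open>p\<close> and \<open>w\<close> down lengthens \<open>u\<close> by at most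
      \<open>(a + 1) + 1\<close>.\<close>
    have "(real a + 1) * ((real a + 1) * N) \<le> (real a + 1) * (real p + 1)"
      using p by (intro mult_left_mono) auto
    moreover have "real u = real n - real w - (real a + 1) * real p"
      using pq \<open>w \<le> n\<close> unfolding u_def q_def by (simp add: algebra_simps)
    moreover have "real n = (real a + 1) * ((real a + 1) * N) + 2 * N"
      using N(3) by (simp add: rD power2_eq_square algebra_simps)
    ultimately have u: "real u \<le> N + (real a + 2)"
      using w by (simp add: algebra_simps)
    have "(real p)\<^sup>2 + (real w)\<^sup>2 + (real u)\<^sup>2 \<le> ((real a + 1) * N)\<^sup>2 + N\<^sup>2 + (N + (real a + 2))\<^sup>2"
      using p w u by (intro add_mono power_mono) auto
    also have "\<dots> = real D * N * N + 2 * (real a + 2) * N + (real a + 2)\<^sup>2"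
      by (simp add: rD power2_eq_square algebra_simps)
    also have "real D * N * N = (real n)\<^sup>2 / real D"
      unfolding N(3) by (simp add: N_def power2_eq_square)
    also have "2 * (real a + 2) * N \<le> 2 * (real a + 2) * real n"
      using N by (intro mult_left_mono) auto
    finally show ?thesis by simp
  qed
  finally have "2 * real a * real (card (mono_triples a n c)) \<le>
      (real n)\<^sup>2 / ((real a)\<^sup>2 + 2 * real a + 3) + 2 * (real a + 2) * real n + (real a + 2)\<^sup>2"
    by (simp add: D_def)
  moreover have "c \<in> colorings n" by (simp add: colorings_def c_def)
  ultimately show ?thesis using that by blast
qed

section \<open>The asymptotic formula\<close>

theorem theorem22:
  fixes a :: nat
  assumes "a \<ge> 2"
  shows "(\<lambda>n. real (min_mono_triples a n)
             - (real n)\<^sup>2 / (2 * real a * ((real a)\<^sup>2 + 2 * real a + 3)))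
         \<in> O(\<lambda>n. real n)"
proof -
  define L where "L n = (real n)\<^sup>2 / (2 * real a * ((real a)\<^sup>2 + 2 * real a + 3))" for n
  \<comment> \<open>The 4 serves the lower bound; the other terms absorb the errors of the upper
    bound.\<close>
  define K where "K = 4 + (real a + 2)\<^sup>2 + 2 * (real a + 2)"
  have a: "1 \<le> 2 * real a" using assms by simp
  have L: "(real n)\<^sup>2 / ((real a)\<^sup>2 + 2 * real a + 3) = 2 * real a * L n" for n
  proof -
    have "X / D = A * (X / (A * D))" if "A \<noteq> 0" for X A D :: real
      using that by simp
    moreover have "2 * real a \<noteq> 0" using a by simp
    ultimately show ?thesis unfolding L_def by blast
  qed
  have "\<bar>real (min_mono_triples a n) - L n\<bar> \<le> K * real n" if n: "a \<le> n" for n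
  proof -
    have fin: "finite ((\<lambda>c. card (mono_triples a n c)) ` colorings n)"
      using finite_colorings by simp
    have "min_mono_triples a n \<in> (\<lambda>c. card (mono_triples a n c)) ` colorings n"
      unfolding min_mono_triples_def using fin colorings_nonempty by (intro Min_in) auto
    then obtain c where c: "min_mono_triples a n = card (mono_triples a n c)" by auto
    \<comment> \<open>For \<open>n \<ge> a\<close> the error
      \<open>17 * a * n + 12 * a\<^sup>2\<close> is at most \<open>29 * a * n\<close>, below
      \<open>8 * a * (4 * n)\<close>.\<close>
    have "real a * real a \<le> real a * real n" using n by (intro mult_left_mono) auto
    moreover have "0 \<le> real a * real n" by simp
    ultimately have "4 * (real n)\<^sup>2 / ((real a)\<^sup>2 + 2 * real a + 3)
        \<le> 8 * real a * (real (min_mono_triples a n) + 4 * real n)"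
      using card_mono_triples_lower[OF assms n, of c] unfolding c
      by (simp only: power2_eq_square distrib_left mult.assoc mult.left_commute[of _ "real a"])
    moreover have "4 * (real n)\<^sup>2 / ((real a)\<^sup>2 + 2 * real a + 3) = 4 * (2 * real a * L n)"
      unfolding L[symmetric] by simp
    ultimately have "8 * real a * L n \<le> 8 * real a * (real (min_mono_triples a n) + 4 * real n)"
      by linarith
    then have "L n \<le> real (min_mono_triples a n) + 4 * real n"
      using a by simp
    moreover have "4 * real n \<le> K * real n"
      by (intro mult_right_mono) (auto simp: K_def)
    ultimately have lower: "L n - K * real n \<le> real (min_mono_triples a n)" by linarith
    obtain d where d: "d \<in> colorings n"
      "2 * real a * real (card (mono_triples a n d)) \<le>
        (real n)\<^sup>2 / ((real a)\<^sup>2 + 2 * real a + 3) + 2 * (real a + 2) * real n + (real a + 2)\<^sup>2"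
      using card_mono_triples_upper[OF assms] by blast
    have "(real a + 2)\<^sup>2 \<le> (real a + 2)\<^sup>2 * real n"
      using n assms mult_left_mono[of 1 "real n" "(real a + 2)\<^sup>2"] by simp
    moreover have "0 \<le> real n" by simp
    ultimately have "2 * (real a + 2) * real n + (real a + 2)\<^sup>2 \<le> K * real n"
      unfolding K_def distrib_right by linarith
    also have "\<dots> \<le> 2 * real a * (K * real n)"
      using mult_right_mono[OF a, of "K * real n"] by (simp add: K_def)
    finally have "2 * real a * real (card (mono_triples a n d)) \<le> 2 * real a * (L n + K * real n)"
      using d(2) unfolding L distrib_left[of "2 * real a" "L n"] by linarith
    then have "real (card (mono_triples a n d)) \<le> L n + K * real n" using a by simp
    moreover have "min_mono_triples a n \<le> card (mono_triples a n d)"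
      unfolding min_mono_triples_def using fin d(1) by (intro Min_le) auto
    ultimately show ?thesis using lower by simp
  qed
  then have "\<forall>\<^sub>F n in sequentially. norm (real (min_mono_triples a n) - L n) \<le> K * norm (real n)"
    by (intro eventually_sequentiallyI[of a]) simp
  then show ?thesis unfolding L_def by (rule bigoI)
qed

end
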